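(* Let $F$, $G$ and $H_k$ be the functions on $[0,1]$ defined in the context. For $x\in[0,1]$ with binary expansion $x=\sum_{i=0}^\infty x_i2^{-i}$ (finite expansion adopted if there are two), the following relationship between $F$ and $G$ holds: $$\begin{aligned}G(x)&=\sum_{i=0}^{\infty}x_i\,4^{\sum_{j=0}^{i-1}(x_j-1)}\left(\frac32\left(\sum_{j=i}^{\infty}\frac{1-x_j}{2^{j-i}}\right)^2-\frac12\prod_{j=i+1}^{\infty}(1-x_j)\right)\\&=\frac32\sum_{i=0}^{\infty}x_i\,4^{\sum_{j=0}^{i-1}x_j}\left(\sum_{j=i}^{\infty}\frac{1-x_j}{2^{j}}\right)^2-\frac12\sum_{i=0}^{\infty}x_i\,4^{\sum_{j=0}^{i-1}(x_j-1)}\prod_{j=i+1}^{\infty}(1-x_j)\\&=\frac32F(x)-\frac12\sum_{i=0}^{\infty}x_i\,4^{\sum_{j=0}^{i-1}(x_j-1)}\prod_{j=i+1}^{\infty}(1-x_j)\\&=\frac32F(x)-\frac12H_{k_x}\left(x+\frac{1}{2^{k_x}}\right),\end{aligned}$$ where $k_x\in\mathbb{Z}_{\ge0}$ satisfies $x_{k_x}=1$ and $x_i=0$ for all $i>k_x$.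
   Context: The functions $F$ and $G$ on $[0,1]$ are $$F(x)=\sum_{i=0}^{\infty}x_i\,4^{\sum_{j=0}^{i-1}x_j}\left(\sum_{j=i}^{\infty}\frac{1-x_j}{2^j}\right)^2,$$ $$G(x)=\sum_{i=0}^{\infty}x_i\,4^{\sum_{j=0}^{i-1}x_j}\left(\frac32\left(\sum_{j=i}^{\infty}\frac{1-x_j}{2^j}\right)^2-\frac{1}{2\cdot4^i}\prod_{j=i+1}^{\infty}(1-x_j)\right),$$ where $x=\sum_{i=0}^{\infty}x_i2^{-i}$, $x_i\in\{0,1\}$, with the finite expansion used whenever $x$ has two binary expansions (so $x_0=1$ only for $x=1$). Empty sums are $0$. For $k\in\mathbb{Z}_{\ge0}$ the function $H_k$ on $[0,1]$ is defined as follows. If $x\in(0,1]$ has at most $k$ binary digits after the point (i.e. $2^kx\in\mathbb{Z}$), write uniquely $x=\frac{1}{2^k}+\sum_{i=1}^{k}\frac{\hat x_i}{2^i}$ with $\hat x_i\in\{0,1\}$ and put $H_k(x)=4^{\sum_{j=1}^{k}\hat x_j}/4^k$. Otherwise (if $x=0$ or $2^kx\notin\mathbb{Z}$) put $H_k(x)=0$.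
   Formalization: The last line is proved with H_{k_x}(x) in place of H_{k_x}(x+1/2^{k_x}), which is false as stated (at x=1/2, G=1/4 but the right side is -1/8); when no k_x exists (x=0 or an infinite expansion) the H-term is read as 0. *)

theory Defs
  imports "HOL-Analysis.Analysis"
begin

definition is_binary_expansion :: "(nat \<Rightarrow> nat) \<Rightarrow> real \<Rightarrow> bool" where
  "is_binary_expansion d x \<longleftrightarrow>
     (\<forall>i. d i \<in> {0, 1}) \<and> (\<lambda>i. real (d i) / 2 ^ i) sums x"

text \<open>The digit of index 0 is the integer part. If there are two expansions, the finite one is chosen;
  this determines the expansion uniquely, see \<open>binary_digit_iff\<close> and \<open>binary_digit_eq_floor\<close>.\<close>

definition binary_digit :: "real \<Rightarrow> nat \<Rightarrow> nat" where
  "binary_digit x = (THE d. is_binary_expansion d x \<and>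
     ((\<exists>e. e \<noteq> d \<and> is_binary_expansion e x) \<longrightarrow> finite {i. d i \<noteq> 0}))"

text \<open>The product of \<open>1 - d j\<close> over \<open>j > i\<close>, as the limit of its partial products. The library's
  \<open>prodinf\<close> is unsuitable: \<open>has_prod\<close> does not hold when infinitely many factors vanish, whereas
  here the product is then 0.\<close>

definition tail_prod :: "(nat \<Rightarrow> nat) \<Rightarrow> nat \<Rightarrow> real" where
  "tail_prod d i = lim (\<lambda>n. \<Prod>j = i + 1..n. 1 - real (d j))"

text \<open>A sum over \<open>j \<ge> i\<close> is written as a series over all naturals by substituting \<open>j + i\<close> for \<open>j\<close>.\<close>

definition F :: "real \<Rightarrow> real" where
  "F x = (let d = binary_digit x in
     \<Sum>i. real (d i) * 4 ^ (\<Sum>j<i. d j) * (\<Sum>j. (1 - real (d (j + i))) / 2 ^ (j + i))\<^sup>2)"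

definition G :: "real \<Rightarrow> real" where
  "G x = (let d = binary_digit x in
     \<Sum>i. real (d i) * 4 ^ (\<Sum>j<i. d j) *
       (3 / 2 * (\<Sum>j. (1 - real (d (j + i))) / 2 ^ (j + i))\<^sup>2
        - 1 / (2 * 4 ^ i) * tail_prod d i))"

text \<open>The digits of indices \<open>1, \<dots>, k\<close> in \<open>x = 1 / 2 ^ k + \<dots>\<close>; the value 0 at the other indices
  only serves to make the function unique.\<close>

definition shifted_digit :: "nat \<Rightarrow> real \<Rightarrow> nat \<Rightarrow> nat" where
  "shifted_digit k x = (THE h. (\<forall>i. h i \<in> {0, 1}) \<and> (\<forall>i. i \<notin> {1..k} \<longrightarrow> h i = 0) \<and>
     x = 1 / 2 ^ k + (\<Sum>i = 1..k. real (h i) / 2 ^ i))"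

definition H :: "nat \<Rightarrow> real \<Rightarrow> real" where
  "H k x = (if 0 < x \<and> x \<le> 1 \<and> 2 ^ k * x \<in> \<int>
            then 4 ^ (\<Sum>j = 1..k. shifted_digit k x j) / 4 ^ k else 0)"

definition last_one :: "real \<Rightarrow> nat \<Rightarrow> bool" where
  "last_one x k \<longleftrightarrow> binary_digit x k = 1 \<and> (\<forall>i>k. binary_digit x i = 0)"

text \<open>Evaluation point of \<open>H\<close>: if \<open>last_one x k\<close>, the only nonzero term of the series over
  \<open>x_i 4 ^ (\<Sum>j<i. x_j - 1) * tail_prod x i\<close> is the one at \<open>i = k\<close>, and it equals \<open>H k x\<close>.
  In the source the argument is \<open>x + 1 / 2 ^ k\<close>. With the present definition of \<open>H\<close>, that gives
  four times the term if \<open>x < 1\<close>, and for \<open>x = 1\<close> it lies outside \<open>[0, 1]\<close>: for instance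
  \<open>G (1/2) = F (1/2) = 1/4\<close>, but \<open>H 1 1 = 1\<close>. The corrected argument \<open>x\<close> is therefore used.\<close>

lemma sums_half_pow_tail: "(\<lambda>i. 1 / 2 ^ (i + Suc m) :: real) sums (1 / 2 ^ m)"
  using sums_mult[OF power_half_series, of "1 / 2 ^ m"]
  by (simp add: power_add power_divide field_simps)

lemma expansions_differ:
  assumes d: "is_binary_expansion d x" and e: "is_binary_expansion e x"
    and eq: "\<And>i. i < m \<Longrightarrow> d i = e i" and dm: "d m = 0" and em: "e m = 1"
  shows "\<forall>j>m. d j = 1 \<and> e j = 0"
proof -
  let ?f = "\<lambda>i. real (d (i + Suc m)) / 2 ^ (i + Suc m)"
  let ?g = "\<lambda>i. real (e (i + Suc m)) / 2 ^ (i + Suc m)"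
  define A where "A = (\<Sum>i<m. real (d i) / 2 ^ i)"
  have A': "A = (\<Sum>i<m. real (e i) / 2 ^ i)"
    unfolding A_def by (rule sum.cong) (auto simp: eq)
  have f: "?f sums (x - A)"
    using sums_split_initial_segment[of "\<lambda>i. real (d i) / 2 ^ i" x "Suc m"] d dm
    by (simp add: is_binary_expansion_def A_def)
  have g: "?g sums (x - (A + 1 / 2 ^ m))"
    using sums_split_initial_segment[of "\<lambda>i. real (e i) / 2 ^ i" x "Suc m"] e em
    by (simp add: is_binary_expansion_def A')
  let ?u = "\<lambda>i. 1 / 2 ^ (i + Suc m) - ?f i + ?g i"
  have u: "?u sums 0"
    using sums_add[OF sums_diff[OF sums_half_pow_tail[of m] f] g] by simp
  have dle: "d i \<le> 1" for i
    using d by (auto simp: is_binary_expansion_def dest!: spec[of _ i])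
  have ele: "e i = 0 \<or> e i = 1" for i
    using e by (auto simp: is_binary_expansion_def)
  have fle: "?f i \<le> 1 / 2 ^ (i + Suc m)" for i
    using dle[of "i + Suc m"] by (intro divide_right_mono) auto
  have g0: "?g i \<ge> 0" for i by simp
  have u0: "?u i \<ge> 0" for i
    by (intro add_nonneg_nonneg g0) (use fle[of i] in simp)
  have "suminf ?u = 0" and "summable ?u" using u by (simp_all only: sums_iff)
  then have "\<forall>i. ?u i = 0" using suminf_eq_zero_iff[of ?u] u0 by blast
  then have u_zero: "?u i = 0" for i by blast
  have arith: "b = a \<and> c = 0" if "a - b + c = 0" "b \<le> a" "0 \<le> c" for a b c :: real
    using that by linarith
  have z: "?f i = 1 / 2 ^ (i + Suc m) \<and> ?g i = 0" for i
    by (rule arith[OF u_zero fle g0])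
  show ?thesis
  proof (intro allI impI)
    fix j assume "m < j"
    then obtain i where j: "j = i + Suc m" by (metis less_iff_Suc_add add_Suc_right add.commute)
    show "d j = 1 \<and> e j = 0" using z[of i] unfolding j by (simp add: field_simps)
  qed
qed

lemma expansions_cases:
  assumes d: "is_binary_expansion d x" and e: "is_binary_expansion e x" and "d \<noteq> e"
  shows "finite {i. d i \<noteq> 0} \<and> (\<exists>m. \<forall>j>m. e j = 1) \<or> finite {i. e i \<noteq> 0} \<and> (\<exists>m. \<forall>j>m. d j = 1)"
proof -
  have ex: "\<exists>m. d m \<noteq> e m" using \<open>d \<noteq> e\<close> by auto
  define m where "m = (LEAST m. d m \<noteq> e m)"
  have m: "d m \<noteq> e m" unfolding m_def using ex by (rule LeastI_ex)
  have lt: "d i = e i" if "i < m" for i using not_less_Least that unfolding m_def by blast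
  have fin: "finite {i. f i \<noteq> 0}" if "\<forall>j>m. f j = 0" for f :: "nat \<Rightarrow> nat"
    by (rule finite_subset[of _ "{..m}"]) (use that in \<open>auto simp: not_less[symmetric]\<close>)
  have "d m \<in> {0,1}" "e m \<in> {0,1}" using d e by (auto simp: is_binary_expansion_def)
  with m consider "d m = 0" "e m = 1" | "e m = 0" "d m = 1" by auto
  then show ?thesis
  proof cases
    case 1
    have *: "\<forall>j>m. d j = 1 \<and> e j = 0" by (rule expansions_differ[OF d e lt 1])
    have "finite {i. e i \<noteq> 0}" by (rule fin) (use * in simp)
    moreover have "\<exists>m. \<forall>j>m. d j = 1" by (rule exI[of _ m]) (use * in simp)
    ultimately show ?thesis by simp
  next
    case 2
    have *: "\<forall>j>m. e j = 1 \<and> d j = 0" by (rule expansions_differ[OF e d lt[symmetric] 2])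
    have "finite {i. d i \<noteq> 0}" by (rule fin) (use * in simp)
    moreover have "\<exists>m. \<forall>j>m. e j = 1" by (rule exI[of _ m]) (use * in simp)
    ultimately show ?thesis by simp
  qed
qed

lemma floor_digits_sum:
  fixes x :: real
  assumes "0 \<le> x" "x < 2"
  shows "(\<Sum>i<Suc n. real (nat (\<lfloor>2 ^ i * x\<rfloor> mod 2)) / 2 ^ i) = real_of_int \<lfloor>2 ^ n * x\<rfloor> / 2 ^ n"
proof (induction n)
  case 0
  have "0 \<le> \<lfloor>x\<rfloor>" "\<lfloor>x\<rfloor> < 2" using assms by (auto simp: floor_less_iff)
  then show ?case by simp
next
  case (Suc n)
  let ?y = "2 ^ n * x"
  have dv: "\<lfloor>2 * ?y\<rfloor> div 2 = \<lfloor>?y\<rfloor>"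
    using floor_divide_real_eq_div[of 2 "2 * ?y"] by simp
  have "\<lfloor>2 * ?y\<rfloor> = 2 * \<lfloor>?y\<rfloor> + \<lfloor>2 * ?y\<rfloor> mod 2"
    using dv by (metis mult_div_mod_eq)
  then have "real_of_int \<lfloor>2 * ?y\<rfloor> = 2 * real_of_int \<lfloor>?y\<rfloor> + real (nat (\<lfloor>2 * ?y\<rfloor> mod 2))"
    by (smt (verit) of_int_add of_int_mult of_int_numeral of_nat_nat pos_mod_sign)
  then show ?case
    unfolding sum.lessThan_Suc[of _ "Suc n"] Suc.IH by (simp add: field_simps)
qed

lemma floor_digits_expansion:
  fixes x :: real
  assumes "0 \<le> x" "x < 2"
  shows "is_binary_expansion (\<lambda>i. nat (\<lfloor>2 ^ i * x\<rfloor> mod 2)) x"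
proof -
  have lim: "(\<lambda>n. real_of_int \<lfloor>2 ^ n * x\<rfloor> / 2 ^ n) \<longlonglongrightarrow> x"
  proof (rule tendsto_sandwich)
    have "x - (1 / 2) ^ n \<le> real_of_int \<lfloor>2 ^ n * x\<rfloor> / 2 ^ n" for n
    proof -
      have "2 ^ n * x - 1 \<le> real_of_int \<lfloor>2 ^ n * x\<rfloor>" by linarith
      then have "(2 ^ n * x - 1) / 2 ^ n \<le> real_of_int \<lfloor>2 ^ n * x\<rfloor> / 2 ^ n"
        by (rule divide_right_mono) simp
      then show ?thesis by (simp add: diff_divide_distrib power_divide)
    qed
    then show "\<forall>\<^sub>F n in sequentially. x - (1 / 2) ^ n \<le> real_of_int \<lfloor>2 ^ n * x\<rfloor> / 2 ^ n" by simp
    have "real_of_int \<lfloor>2 ^ n * x\<rfloor> / 2 ^ n \<le> x" for n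
      using of_int_floor_le[of "2 ^ n * x"] by (simp add: divide_le_eq mult.commute)
    then show "\<forall>\<^sub>F n in sequentially. real_of_int \<lfloor>2 ^ n * x\<rfloor> / 2 ^ n \<le> x" by simp
    show "(\<lambda>n. x - (1 / 2) ^ n) \<longlonglongrightarrow> x"
      using tendsto_diff[OF tendsto_const[of x] LIMSEQ_realpow_zero[of "1/2"]] by simp
  qed simp
  have "(\<lambda>i. real (nat (\<lfloor>2 ^ i * x\<rfloor> mod 2)) / 2 ^ i) sums x"
    unfolding sums_def
    by (subst filterlim_sequentially_Suc[symmetric]) (simp only: floor_digits_sum[OF assms] lim)
  moreover have "nat (k mod 2) \<in> {0, 1}" for k :: int by (cases "even k") (auto simp: odd_iff_mod_2_eq_one)
  ultimately show ?thesis unfolding is_binary_expansion_def by blast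
qed

lemma floor_digits_not_ev_one:
  fixes x :: real
  assumes "0 \<le> x" "x < 2"
  shows "\<not> (\<forall>j>m. nat (\<lfloor>2 ^ j * x\<rfloor> mod 2) = 1)"
proof
  assume 1: "\<forall>j>m. nat (\<lfloor>2 ^ j * x\<rfloor> mod 2) = 1"
  let ?f = "\<lambda>i. real (nat (\<lfloor>2 ^ i * x\<rfloor> mod 2)) / 2 ^ i"
  have "?f sums x" using floor_digits_expansion[OF assms] by (simp add: is_binary_expansion_def)
  then have "(\<lambda>i. ?f (i + Suc m)) sums (x - real_of_int \<lfloor>2 ^ m * x\<rfloor> / 2 ^ m)"
    using sums_split_initial_segment[of ?f x "Suc m"] floor_digits_sum[OF assms, of m] by simp
  moreover have "(\<lambda>i. ?f (i + Suc m)) = (\<lambda>i. 1 / 2 ^ (i + Suc m))"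
  proof
    fix i
    have "nat (\<lfloor>2 ^ (i + Suc m) * x\<rfloor> mod 2) = 1" using 1[rule_format, of "i + Suc m"] by simp
    then show "?f (i + Suc m) = 1 / 2 ^ (i + Suc m)" by (simp only: of_nat_1)
  qed
  ultimately have "x - real_of_int \<lfloor>2 ^ m * x\<rfloor> / 2 ^ m = 1 / 2 ^ m"
    using sums_half_pow_tail[of m] sums_unique2 by metis
  then have "2 ^ m * x = real_of_int \<lfloor>2 ^ m * x\<rfloor> + 1" by (simp add: field_simps)
  then show False by linarith
qed

lemma binary_digit_aux:
  fixes x :: real
  assumes "0 \<le> x" "x < 2"
  shows "is_binary_expansion d x \<and>
     ((\<exists>e. e \<noteq> d \<and> is_binary_expansion e x) \<longrightarrow> finite {i. d i \<noteq> 0}) \<longleftrightarrow>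
     d = (\<lambda>i. nat (\<lfloor>2 ^ i * x\<rfloor> mod 2))" (is "?P d \<longleftrightarrow> d = ?e")
proof -
  have e: "is_binary_expansion ?e x" by (rule floor_digits_expansion[OF assms])
  have ne: "\<not> (\<forall>j>m. ?e j = 1)" for m by (rule floor_digits_not_ev_one[OF assms])
  have fin1: "\<not> (\<forall>j>m. f j = 1)" if fin: "finite {i. f i \<noteq> 0}" for f :: "nat \<Rightarrow> nat" and m
  proof
    assume "\<forall>j>m. f j = 1"
    then have "{m<..} \<subseteq> {i. f i \<noteq> 0}" by auto
    with fin have "finite {m<..}" by (rule rev_finite_subset)
    then show False by (simp add: infinite_Ioi)
  qed
  show ?thesis
  proof
    assume P: "?P d"
    show "d = ?e"
    proof (rule ccontr)
      assume neq: "d \<noteq> ?e"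
      have "\<exists>e. e \<noteq> d \<and> is_binary_expansion e x"
        using neq[symmetric] e by (intro exI[of _ ?e] conjI)
      with P have fin: "finite {i. d i \<noteq> 0}" by (rule conjunct2[THEN mp])
      from P have "is_binary_expansion d x" by (rule conjunct1)
      from expansions_cases[OF this e neq] show False
        using ne fin1[OF fin] by metis
    qed
  next
    assume d: "d = ?e"
    have "finite {i. ?e i \<noteq> 0}" if "is_binary_expansion f x" "f \<noteq> ?e" for f
      using expansions_cases[OF that(1) e that(2)] ne by blast
    then show "?P d" using e unfolding d by blast
  qed
qed

lemma binary_digit_eq_floor:
  assumes "0 \<le> x" "x \<le> 1"
  shows "binary_digit x i = nat (\<lfloor>2 ^ i * x\<rfloor> mod 2)"
proof -
  have "binary_digit x = (\<lambda>i. nat (\<lfloor>2 ^ i * x\<rfloor> mod 2))"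
    unfolding binary_digit_def
  proof (rule the_equality, goal_cases)
    case 1
    show ?case by (rule iffD2[OF binary_digit_aux refl]) (use assms in auto)
  next
    case (2 d)
    show ?case by (rule iffD1[OF binary_digit_aux 2]) (use assms in auto)
  qed
  then show ?thesis by simp
qed

lemma binary_digit_iff:
  assumes "0 \<le> x" "x \<le> 1"
  shows "d = binary_digit x \<longleftrightarrow> is_binary_expansion d x \<and>
     ((\<exists>e. e \<noteq> d \<and> is_binary_expansion e x) \<longrightarrow> finite {i. d i \<noteq> 0})"
proof -
  have "binary_digit x = (\<lambda>i. nat (\<lfloor>2 ^ i * x\<rfloor> mod 2))"
    using binary_digit_eq_floor[OF assms] by (rule ext)
  then show ?thesis using binary_digit_aux[of x d] assms by simp
qed

end

theory Submission
  imports Defs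
begin

text \<open>Pulling \<open>4 ^ (- i)\<close> out of the bracket gives the first form of \<open>G\<close>, and the second and third
  follow by splitting the series, once the series of \<open>F\<close> is known to converge. For the latter, let
  \<open>t\<^sub>i\<close> be the \<open>i\<close>-th tail, \<open>s\<^sub>i\<close> the number of ones before \<open>i\<close>, \<open>b\<^sub>i = 4 ^ s\<^sub>i * t\<^sub>i\<^sup>2\<close> and
  \<open>w\<^sub>i = 4 ^ (s\<^sub>i - i)\<close>. At a digit 1, \<open>b\<close> is multiplied by 4 and \<open>w\<close> is unchanged; at a digit 0,
  \<open>w\<close> is divided by 4; and always \<open>b\<^sub>i \<le> 4 * w\<^sub>i\<close>. Hence the \<open>n\<close>-th partial sum of \<open>F\<close> is at most
  \<open>b\<^sub>n / 3 + 16 / 9 * (1 - w\<^sub>n)\<close>, by induction. Finally, \<open>x\<^sub>i\<close> times the product over \<open>j > i\<close> is nonzero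
  only at the last digit 1.\<close>

definition zeros_tail :: "(nat \<Rightarrow> nat) \<Rightarrow> nat \<Rightarrow> real" where
  "zeros_tail d i = (\<Sum>j. (1 - real (d (j + i))) / 2 ^ (j + i))"

context
  fixes d :: "nat \<Rightarrow> nat"
  assumes digit: "\<And>i. d i \<in> {0, 1}"
begin

lemma digit_cases: "d i = 0 \<or> d i = 1"
  using digit[of i] by simp

lemma summable_zeros_scaled: "summable (\<lambda>j. (1 - real (d (j + i))) / 2 ^ j)"
proof (rule summable_comparison_test'[of "\<lambda>j. (1 / 2) ^ j :: real" 0])
  show "summable (\<lambda>j. (1 / 2) ^ j :: real)" by (rule summable_geometric) simp
  show "norm ((1 - real (d (j + i))) / 2 ^ j) \<le> (1 / 2) ^ j" for j
    using digit_cases[of "j + i"] by (auto simp: power_divide)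
qed

lemma zeros_tail_eq: "zeros_tail d i = (\<Sum>j. (1 - real (d (j + i))) / 2 ^ j) / 2 ^ i"
  unfolding zeros_tail_def suminf_divide[OF summable_zeros_scaled, symmetric]
  by (simp add: power_add)

lemma zeros_tail_nonneg: "0 \<le> zeros_tail d i"
  unfolding zeros_tail_eq
  using digit_cases by (intro divide_nonneg_nonneg suminf_nonneg summable_zeros_scaled)
    (metis diff_ge_0_iff_ge of_nat_0_le_iff of_nat_le_1_iff le_numeral_extra(4) zero_le_one, auto)

lemma zeros_tail_le: "zeros_tail d i \<le> 2 / 2 ^ i"
proof -
  have "(\<Sum>j. (1 - real (d (j + i))) / 2 ^ j) \<le> (\<Sum>j. (1 / 2) ^ j)"
    by (rule suminf_le[OF _ summable_zeros_scaled summable_geometric])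
      (auto simp: power_divide divide_right_mono)
  also have "\<dots> = 2" by (simp add: suminf_geometric)
  finally show ?thesis unfolding zeros_tail_eq by (rule divide_right_mono) simp
qed

text \<open>The head term of the tail vanishes at a digit 1. Passing such a digit therefore
  multiplies \<open>b_i\<close> by exactly 4.\<close>

lemma zeros_tail_Suc_one:
  assumes "d i = 1"
  shows "zeros_tail d (Suc i) = zeros_tail d i"
proof -
  have "summable (\<lambda>j. (1 - real (d (j + i))) / 2 ^ (j + i))"
    using summable_divide[OF summable_zeros_scaled[of i], of "2 ^ i"] by (simp add: power_add)
  from suminf_split_head[OF this] show ?thesis
    using assms by (simp add: zeros_tail_def)
qed

lemma partial_sum_F_le:
  "(\<Sum>i<n. real (d i) * 4 ^ (\<Sum>j<i. d j) * (zeros_tail d i)\<^sup>2)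
     \<le> 4 ^ (\<Sum>j<n. d j) * (zeros_tail d n)\<^sup>2 / 3 + 16 / 9 - 16 / 9 * (4 ^ (\<Sum>j<n. d j) / 4 ^ n)"
    (is "?P n \<le> ?b n / 3 + _ - _")
  and weighted_zeros_tail_le:
  "4 ^ (\<Sum>j<n. d j) * (zeros_tail d n)\<^sup>2 \<le> 4 * (4 ^ (\<Sum>j<n. d j) / 4 ^ n)"
proof -
  define w where "w n = (4 ^ (\<Sum>j<n. d j) / 4 ^ n :: real)" for n
  have b: "?b n \<le> 4 * w n" for n
  proof -
    have "(zeros_tail d n)\<^sup>2 \<le> (2 / 2 ^ n)\<^sup>2"
      by (rule power_mono[OF zeros_tail_le zeros_tail_nonneg])
    also have "(2 / 2 ^ n)\<^sup>2 = (4 / 4 ^ n :: real)"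
      by (simp add: power_divide power2_eq_square flip: power_mult_distrib)
    finally have "?b n \<le> 4 ^ (\<Sum>j<n. d j) * (4 / 4 ^ n)" by (rule mult_left_mono) simp
    then show ?thesis by (simp add: w_def mult.commute)
  qed
  then show "?b n \<le> 4 * (4 ^ (\<Sum>j<n. d j) / 4 ^ n)" unfolding w_def .
  show "?P n \<le> ?b n / 3 + 16 / 9 - 16 / 9 * (4 ^ (\<Sum>j<n. d j) / 4 ^ n)"
    unfolding w_def[symmetric]
  proof (induction n)
    case 0
    then show ?case by (simp add: w_def)
  next
    case (Suc n)
    from digit_cases[of n] show ?case
    proof
      assume "d n = 0"
      then have "w (Suc n) = w n / 4" and "?P (Suc n) = ?P n" by (simp_all add: w_def)
      moreover have "0 \<le> ?b (Suc n)" by simp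
      ultimately show ?thesis using Suc.IH b[of n] by linarith
    next
      \<comment> \<open>Here both sides grow by the same amount: the new summand is
        \<open>b n\<close>, while \<open>b / 3\<close> grows by \<open>(4 * b n - b n) / 3\<close>.
        This fixes the factor 1/3.\<close>
      assume "d n = 1"
      then show ?thesis using Suc.IH zeros_tail_Suc_one[of n] by (simp add: w_def)
    qed
  qed
qed

lemma summable_F: "summable (\<lambda>i. real (d i) * 4 ^ (\<Sum>j<i. d j) * (zeros_tail d i)\<^sup>2)"
proof (rule summableI_nonneg_bounded)
  show "(\<Sum>i<n. real (d i) * 4 ^ (\<Sum>j<i. d j) * (zeros_tail d i)\<^sup>2) \<le> 16 / 9" for n
  proof -
    define w where "w = (4 ^ (\<Sum>j<n. d j) / 4 ^ n :: real)"
    have "0 \<le> w" by (simp add: w_def)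
    \<comment> \<open>\<open>b n / 3 \<le> 4/3 * w \<le> 16/9 * w\<close>, so the terms depending on
      \<open>n\<close> contribute at most 0.\<close>
    then show ?thesis
      using partial_sum_F_le[of n] weighted_zeros_tail_le[of n] unfolding w_def[symmetric] by linarith
  qed
qed simp

text \<open>A digit 1 after \<open>i\<close> puts a factor 0 into every later partial product;
  without one, all factors are 1.\<close>

lemma tail_prod_eq: "tail_prod d i = (if \<forall>j>i. d j = 0 then 1 else 0)"
proof (cases "\<forall>j>i. d j = 0")
  case True
  then have "(\<lambda>n. \<Prod>j = i + 1..n. 1 - real (d j)) = (\<lambda>n. 1)" by simp
  then show ?thesis using True by (simp add: tail_prod_def)
next
  case False
  then obtain m where "m > i" "d m = 1" using digit_cases by metis
  then have "(\<Prod>j = i + 1..n. 1 - real (d j)) = 0" if "n \<ge> m" for n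
    using that by (auto intro!: bexI[of _ m])
  then have "(\<lambda>n. \<Prod>j = i + 1..n. 1 - real (d j)) \<longlonglongrightarrow> 0"
    by (intro tendsto_eventually) (auto simp: eventually_sequentially)
  then show ?thesis using False by (simp add: tail_prod_def limI)
qed

lemma powi_sum_digits: "4 powi (\<Sum>j<i. int (d j) - 1) = (4 ^ (\<Sum>j<i. d j) / 4 ^ i :: real)"
proof -
  have "(\<Sum>j<i. int (d j) - 1) = int (\<Sum>j<i. d j) - int i" by (simp add: sum_subtractf)
  then show ?thesis by (simp add: power_int_diff del: of_nat_sum)
qed

lemma sums_tail_prod_last_one:
  assumes "d k = 1" and "\<forall>i>k. d i = 0"
  shows "(\<lambda>i. real (d i) * 4 powi (\<Sum>j<i. int (d j) - 1) * tail_prod d i)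
           sums (4 ^ (\<Sum>j<k. d j) / 4 ^ k)"
proof -
  have "real (d i) * 4 powi (\<Sum>j<i. int (d j) - 1) * tail_prod d i =
      (if i = k then 4 ^ (\<Sum>j<k. d j) / 4 ^ k else 0)" for i
    using assms by (cases i k rule: linorder_cases) (auto simp: tail_prod_eq powi_sum_digits)
  then show ?thesis using sums_single[of k "\<lambda>_. 4 ^ (\<Sum>j<k. d j) / 4 ^ k :: real"] by simp
qed

text \<open>Every digit 1 is followed by another, which kills the product. This covers
  \<open>x = 0\<close> as well as infinitely many ones.\<close>

lemma tail_prod_term_no_last_one:
  assumes "\<nexists>k. d k = 1 \<and> (\<forall>i>k. d i = 0)"
  shows "real (d i) * 4 powi (\<Sum>j<i. int (d j) - 1) * tail_prod d i = 0"
  using assms digit_cases[of i] by (auto simp: tail_prod_eq)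

lemma summable_tail_prod:
  "summable (\<lambda>i. real (d i) * 4 powi (\<Sum>j<i. int (d j) - 1) * tail_prod d i)"
proof (cases "\<exists>k. d k = 1 \<and> (\<forall>i>k. d i = 0)")
  case True
  then show ?thesis using sums_tail_prod_last_one by (blast intro: sums_summable)
next
  case False
  show ?thesis unfolding tail_prod_term_no_last_one[OF False] by (rule summable_zero)
qed

end

text \<open>Two candidates are both binary expansions of \<open>x - 1 / 2 ^ k\<close>. If they
  differed, one of them would be eventually 1 by \<open>expansions_cases\<close>, but both vanish
  beyond \<open>k\<close>.\<close>

lemma shifted_digit_eq:
  assumes h: "\<And>i. h i \<in> {0, 1}" "\<And>i. i \<notin> {1..k} \<Longrightarrow> h i = 0"
    and x: "x = 1 / 2 ^ k + (\<Sum>i = 1..k. real (h i) / 2 ^ i)"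
  shows "shifted_digit k x = h"
  unfolding shifted_digit_def
proof (rule the_equality)
  show "(\<forall>i. h i \<in> {0, 1}) \<and> (\<forall>i. i \<notin> {1..k} \<longrightarrow> h i = 0) \<and>
      x = 1 / 2 ^ k + (\<Sum>i = 1..k. real (h i) / 2 ^ i)"
    using assms by blast
next
  fix g
  assume g: "(\<forall>i. g i \<in> {0, 1}) \<and> (\<forall>i. i \<notin> {1..k} \<longrightarrow> g i = 0) \<and>
      x = 1 / 2 ^ k + (\<Sum>i = 1..k. real (g i) / 2 ^ i)"
  have expansion: "is_binary_expansion f (x - 1 / 2 ^ k)"
    if "\<And>i. f i \<in> {0, 1}" "\<And>i. i \<notin> {1..k} \<Longrightarrow> f i = 0"
      "x = 1 / 2 ^ k + (\<Sum>i = 1..k. real (f i) / 2 ^ i)" for f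
    using that sums_finite[of "{1..k}" "\<lambda>i. real (f i) / 2 ^ i"]
    by (auto simp: is_binary_expansion_def)
  have not_ev_one: "\<not> (\<exists>m. \<forall>j>m. f j = 1)" if "\<And>i. i \<notin> {1..k} \<Longrightarrow> f i = 0" for f :: "nat \<Rightarrow> nat"
  proof
    assume "\<exists>m. \<forall>j>m. f j = 1"
    then obtain m where "\<forall>j>m. f j = 1" ..
    then have "f (Suc (max m k)) = 1" by simp
    then show False using that[of "Suc (max m k)"] by simp
  qed
  show "g = h"
    using expansions_cases[OF expansion[of g] expansion[of h]] not_ev_one[of g] not_ev_one[of h] g assms
    by blast
qed

text \<open>The last digit 1 of \<open>x\<close> supplies the separate summand
  \<open>1 / 2 ^ k\<close> in the definition of \<open>H\<close>, so the shifted digits are the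
  digits of \<open>x\<close> before \<open>k\<close>.\<close>

lemma H_last_one:
  assumes "0 \<le> x" "x \<le> 1" and k: "last_one x k"
  shows "H k x = 4 ^ (\<Sum>j<k. binary_digit x j) / 4 ^ k"
proof -
  define d where "d = binary_digit x"
  have exp: "is_binary_expansion d x" using binary_digit_iff[OF assms(1,2)] d_def by blast
  then have digit: "d i \<in> {0, 1}" for i by (simp add: is_binary_expansion_def)
  have dk: "d k = 1" "\<And>i. i > k \<Longrightarrow> d i = 0" using k by (auto simp: last_one_def d_def)
  have "(\<lambda>i. real (d i) / 2 ^ i) sums (\<Sum>i\<le>k. real (d i) / 2 ^ i)"
    by (rule sums_finite) (auto simp: dk(2))
  then have x: "x = 1 / 2 ^ k + (\<Sum>i<k. real (d i) / 2 ^ i)"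
    using exp sums_unique2 dk(1) by (fastforce simp: is_binary_expansion_def lessThan_Suc_atMost[symmetric])
  \<comment> \<open>Shifted digits start at index 1, so the digit at 0 must not be lost. If it were
    1, the further digit 1 at \<open>k\<close> would push \<open>x\<close> above 1.\<close>
  have d0: "d 0 = 0" if "k > 0"
  proof (rule ccontr)
    assume "d 0 \<noteq> 0"
    then have "1 \<le> real (d 0) / 2 ^ 0" by simp
    also have "\<dots> \<le> (\<Sum>i<k. real (d i) / 2 ^ i)"
      by (rule member_le_sum) (use that in auto)
    finally have "1 \<le> (\<Sum>i<k. real (d i) / 2 ^ i)" .
    moreover have "0 < 1 / (2 ^ k :: real)" by simp
    ultimately show False using x assms(2) by linarith
  qed
  define h where "h i = (if i < k then d i else 0)" for i
  have h0: "h 0 = 0" using d0 by (simp add: h_def)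
  \<comment> \<open>The two index ranges differ at most in 0 and \<open>k\<close>, where
    \<open>h\<close> vanishes. For \<open>k = 0\<close>, that is \<open>x = 1\<close>, both are
    empty.\<close>
  have reindex: "(\<Sum>i = 1..k. f i) = (\<Sum>i<k. f i)" if "f 0 = 0" "f k = 0" for f :: "nat \<Rightarrow> 'a::comm_monoid_add"
    by (rule sum.mono_neutral_cong) (use that in \<open>auto simp: not_less_eq_eq intro: le_antisym\<close>)
  have hsum: "(\<Sum>i = 1..k. real (h i) / 2 ^ i) = (\<Sum>i<k. real (d i) / 2 ^ i)"
    by (subst reindex) (auto simp: h0, auto simp: h_def)
  have shifted: "shifted_digit k x = h"
    by (rule shifted_digit_eq) (use digit x hsum h0 in \<open>auto simp: h_def not_less_eq_eq\<close>)
  have "(\<Sum>j = 1..k. h j) = (\<Sum>j<k. d j)"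
    by (subst reindex) (auto simp: h0, auto simp: h_def)
  moreover have "2 ^ k * x \<in> \<int>"
  proof -
    have "2 ^ k * (real (d i) / 2 ^ i) = real (d i * 2 ^ (k - i))" if "i < k" for i
      using that power_add[of "2 :: real" i "k - i"] by simp
    then have "2 ^ k * x = 1 + (\<Sum>i<k. real (d i * 2 ^ (k - i)))"
      by (subst x) (simp add: distrib_left sum_distrib_left del: of_nat_mult)
    then show ?thesis by (simp del: of_nat_mult of_nat_sum add: of_nat_sum[symmetric])
  qed
  moreover have "0 < x" by (subst x) (simp add: add_pos_nonneg sum_nonneg)
  ultimately show ?thesis using assms(2) by (simp add: H_def shifted d_def)
qed

theorem lemma2:
  fixes x :: real
  assumes "0 \<le> x" and "x \<le> 1"
  shows "G x = (\<Sum>i. real (binary_digit x i) * 4 powi (\<Sum>j<i. int (binary_digit x j) - 1) *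
             (3 / 2 * (\<Sum>j. (1 - real (binary_digit x (j + i))) / 2 ^ j)\<^sup>2
              - 1 / 2 * tail_prod (binary_digit x) i))
       \<and> G x = 3 / 2 * (\<Sum>i. real (binary_digit x i) * 4 ^ (\<Sum>j<i. binary_digit x j) *
                 (\<Sum>j. (1 - real (binary_digit x (j + i))) / 2 ^ (j + i))\<^sup>2)
             - 1 / 2 * (\<Sum>i. real (binary_digit x i) * 4 powi (\<Sum>j<i. int (binary_digit x j) - 1) *
                 tail_prod (binary_digit x) i)
       \<and> G x = 3 / 2 * F x
             - 1 / 2 * (\<Sum>i. real (binary_digit x i) * 4 powi (\<Sum>j<i. int (binary_digit x j) - 1) *
                 tail_prod (binary_digit x) i)
       \<and> (\<forall>k. last_one x k \<longrightarrow> G x = 3 / 2 * F x - 1 / 2 * H k x)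
       \<and> ((\<nexists>k. last_one x k) \<longrightarrow> G x = 3 / 2 * F x)"
proof -
  define d where "d = binary_digit x"
  define T where "T i = real (d i) * 4 powi (\<Sum>j<i. int (d j) - 1) * tail_prod d i" for i
  have "is_binary_expansion d x" using binary_digit_iff[OF assms] d_def by blast
  then have digit: "d i \<in> {0, 1}" for i by (simp add: is_binary_expansion_def)
  have F: "F x = (\<Sum>i. real (d i) * 4 ^ (\<Sum>j<i. d j) * (zeros_tail d i)\<^sup>2)"
    by (simp add: F_def d_def zeros_tail_def Let_def)
  have G: "G x = (\<Sum>i. real (d i) * 4 ^ (\<Sum>j<i. d j) *
      (3 / 2 * (zeros_tail d i)\<^sup>2 - 1 / (2 * 4 ^ i) * tail_prod d i))"
    by (simp add: G_def d_def zeros_tail_def Let_def)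
  have first: "G x = (\<Sum>i. real (d i) * 4 powi (\<Sum>j<i. int (d j) - 1) *
      (3 / 2 * (\<Sum>j. (1 - real (d (j + i))) / 2 ^ j)\<^sup>2 - 1 / 2 * tail_prod d i))"
    unfolding G
  proof (rule arg_cong[where f = suminf], rule ext)
    fix i
    \<comment> \<open>The factor \<open>1 / 2 ^ i\<close> of the tail is squared, so both terms of
      the bracket carry the same \<open>1 / 4 ^ i\<close>, which the integer power absorbs.\<close>
    have "(2 ^ i)\<^sup>2 = (4 ^ i :: real)" by (simp add: power2_eq_square flip: power_mult_distrib)
    then show "real (d i) * 4 ^ (\<Sum>j<i. d j) *
        (3 / 2 * (zeros_tail d i)\<^sup>2 - 1 / (2 * 4 ^ i) * tail_prod d i) =
      real (d i) * 4 powi (\<Sum>j<i. int (d j) - 1) *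
        (3 / 2 * (\<Sum>j. (1 - real (d (j + i))) / 2 ^ j)\<^sup>2 - 1 / 2 * tail_prod d i)"
      by (simp add: powi_sum_digits[OF digit] zeros_tail_eq[OF digit] power_divide field_simps)
  qed
  have "G x = (\<Sum>i. 3 / 2 * (real (d i) * 4 ^ (\<Sum>j<i. d j) * (zeros_tail d i)\<^sup>2) - 1 / 2 * T i)"
    unfolding G T_def
    by (rule arg_cong[where f = suminf], rule ext) (simp add: powi_sum_digits[OF digit] field_simps)
  \<comment> \<open>Termwise splitting is legitimate because both series converge.\<close>
  also have "\<dots> = 3 / 2 * F x - 1 / 2 * suminf T"
    unfolding F T_def
    by (intro sums_unique[symmetric] sums_diff sums_mult summable_sums
        summable_F[of d, OF digit] summable_tail_prod[of d, OF digit])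
  finally have third: "G x = 3 / 2 * F x - 1 / 2 * suminf T" .
  have "suminf T = H k x" if "last_one x k" for k
    using sums_tail_prod_last_one[of d k, OF digit] that H_last_one[OF assms that]
    by (auto simp: T_def[abs_def] d_def last_one_def sums_iff)
  moreover have "suminf T = 0" if "\<nexists>k. last_one x k"
  proof -
    have "\<nexists>k. d k = 1 \<and> (\<forall>i>k. d i = 0)" using that by (simp add: d_def last_one_def)
    then have "T = (\<lambda>i. 0)"
      unfolding T_def using tail_prod_term_no_last_one[of d, OF digit] by blast
    then show ?thesis by simp
  qed
  ultimately have "\<forall>k. last_one x k \<longrightarrow> G x = 3 / 2 * F x - 1 / 2 * H k x"
    and "(\<nexists>k. last_one x k) \<longrightarrow> G x = 3 / 2 * F x"
    using third by simp_all
  then show ?thesis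
    using first third third[unfolded F] unfolding T_def zeros_tail_def d_def by (intro conjI)
qed

end
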